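(* Let $n\ge 1$ be an integer, let $P_{1,\mathrm{exp}},\ldots,P_{n,\mathrm{exp}}$ be pairwise distinct positive real numbers, and let $P_{\mathrm{tot}}\ge 0$. Let $P_1,\ldots,P_n$ be statistically independent random variables such that, for each $i$, $P_i$ is exponentially distributed with expected value $P_{i,\mathrm{exp}}$, and let $P=P_1+\cdots+P_n$. Then $$\mathrm{prob}(P\ge P_{\mathrm{tot}})=\sum_{i=1}^{n}\frac{P_{i,\mathrm{exp}}^{\,n-1}\,e^{-P_{\mathrm{tot}}/P_{i,\mathrm{exp}}}}{\prod_{1\le j\le n,\ j\ne i}\left(P_{i,\mathrm{exp}}-P_{j,\mathrm{exp}}\right)}.$$
   Context: A random variable is exponentially distributed with expected value $c>0$ if it has probability density $\frac1c e^{-x/c}$ for $x\ge 0$ (and $0$ for $x<0$). Equivalently, the probability in the claim is given by the iterated integral $$\mathrm{prob}(P\ge P_{\mathrm{tot}})=1-\int_0^{P_{\mathrm{tot}}}\frac{e^{-P_1/P_{1,\mathrm{exp}}}}{P_{1,\mathrm{exp}}}\left[\int_0^{P_{\mathrm{tot}}-P_1}\frac{e^{-P_2/P_{2,\mathrm{exp}}}}{P_{2,\mathrm{exp}}}\cdots\left[\int_0^{P_{\mathrm{tot}}-\sum_{i=1}^{n-1}P_i}\frac{e^{-P_n/P_{n,\mathrm{exp}}}}{P_{n,\mathrm{exp}}}\,dP_n\right]\cdots dP_2\right]dP_1 .$$ An empty product equals $1$. *)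

theory Defs
  imports "HOL-Probability.Probability"
begin

end

theory Submission
  imports Defs
begin

text \<open>
  The density of \<open>P\<^sub>1 + \<dots> + P\<^sub>n\<close> is a linear combination, with signed coefficients, of the
  densities of the \<open>P\<^sub>i\<close>. The reason is that convolution almost acts diagonally on exponential
  densities: writing \<open>e\<^sub>c\<close> for the exponential density of mean \<open>c\<close>, two distinct means satisfy
  \<open>e\<^sub>c * e\<^sub>d = c / (c - d) e\<^sub>c + d / (d - c) e\<^sub>d\<close> (\<open>exponential_density_convolution\<close>).
  Adding a variable of mean \<open>a k\<close> therefore multiplies the coefficient of the density of mean
  \<open>a i\<close> by \<open>a i / (a i - a k)\<close>, which makes that coefficient the product \<open>hypoexp_weight\<close>.
  The coefficient of the new density comes out as a sum over the old means, and a partial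
  fraction identity (\<open>sum_hypoexp_weight\<close>) turns this sum into a product of the same shape.

  Since the coefficients can be negative, a convolution cannot be split inside the nonnegative
  integral that defines it. It is evaluated as a Bochner integral, and the induction
  (\<open>distributed_sum_exponential\<close>) carries along that the combined density is nonnegative so that
  the two integrals agree. Integrating the density over the half-line above the threshold gives
  the claim, the factor \<open>(a i) ^ (n - 1)\<close> being the collected numerators of the weight.
\<close>

section \<open>Partial fractions\<close>

definition hypoexp_weight :: "('i \<Rightarrow> real) \<Rightarrow> 'i set \<Rightarrow> 'i \<Rightarrow> real" where
  "hypoexp_weight a I i = (\<Prod>j\<in>I - {i}. a i / (a i - a j))"

lemma hypoexp_weight_insert:
  assumes "finite I" "k \<notin> I" "i \<in> I"
  shows "hypoexp_weight a (insert k I) i = hypoexp_weight a I i * (a i / (a i - a k))"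
proof -
  have "insert k I - {i} = insert k (I - {i})"
    using assms by auto
  then show ?thesis
    using assms by (simp add: hypoexp_weight_def mult.commute)
qed

lemma hypoexp_weight_insert_new:
  assumes "k \<notin> I"
  shows "hypoexp_weight a (insert k I) k = (\<Prod>j\<in>I. a k / (a k - a j))"
  using assms by (simp add: hypoexp_weight_def)

lemma hypoexp_weight_eq_quotient:
  assumes "finite I" "i \<in> I"
  shows "hypoexp_weight a I i = a i ^ (card I - 1) / (\<Prod>j\<in>I - {i}. a i - a j)"
  using assms by (simp add: hypoexp_weight_def prod_dividef)

text \<open>
  This is the partial fraction expansion of the right-hand side as a function of \<open>b\<close>. Adjoining
  an index \<open>k\<close> uses the identity for \<open>I\<close> twice: at \<open>b = a k\<close>, to rewrite the weight of \<open>k\<close> as a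
  sum over \<open>I\<close>, and at \<open>b\<close>, after the two fractions belonging to each \<open>i \<in> I\<close> have been combined.
\<close>
lemma sum_hypoexp_weight:
  fixes a :: "'i \<Rightarrow> real"
  assumes "finite I" "I \<noteq> {}" "inj_on a I" "b \<notin> a ` I"
  shows "(\<Sum>i\<in>I. hypoexp_weight a I i * (b / (b - a i))) = (\<Prod>i\<in>I. b / (b - a i))"
  using assms
proof (induction I arbitrary: b rule: finite_ne_induct)
  case (singleton i)
  then show ?case by (simp add: hypoexp_weight_def)
next
  case (insert k I)
  have inj: "inj_on a I" and ak: "a k \<notin> a ` I" and b: "b \<notin> a ` I" "b \<noteq> a k"
    using insert by auto
  have new: "hypoexp_weight a (insert k I) k
      = (\<Sum>i\<in>I. hypoexp_weight a I i * (a k / (a k - a i)))"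
    using insert.IH[OF inj ak] insert.hyps by (simp add: hypoexp_weight_insert_new)
  have "(\<Sum>i\<in>insert k I. hypoexp_weight a (insert k I) i * (b / (b - a i)))
      = (\<Sum>i\<in>I. hypoexp_weight a I i * (a k / (a k - a i))) * (b / (b - a k))
        + (\<Sum>i\<in>I. hypoexp_weight a I i * (a i / (a i - a k)) * (b / (b - a i)))"
    using insert.hyps by (simp add: new hypoexp_weight_insert)
  also have "\<dots> = (\<Sum>i\<in>I. hypoexp_weight a I i *
      (a k / (a k - a i) * (b / (b - a k)) + a i / (a i - a k) * (b / (b - a i))))"
    by (simp only: sum_distrib_right sum.distrib[symmetric] distrib_left mult.assoc)
  also have "\<dots> = (\<Sum>i\<in>I. hypoexp_weight a I i * (b / (b - a i) * (b / (b - a k))))"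
  proof (intro sum.cong refl arg_cong2[where f = "(*)"])
    fix i assume "i \<in> I"
    then have "a i \<noteq> a k"
      using ak by (metis imageI)
    moreover have "b \<noteq> a i"
      using b(1) \<open>i \<in> I\<close> by (metis imageI)
    ultimately have ne: "a i - a k \<noteq> 0" "a k - a i \<noteq> 0" "b - a i \<noteq> 0" "b - a k \<noteq> 0"
      using b by simp_all
    have "a k / (a k - a i) * (b / (b - a k)) + a i / (a i - a k) * (b / (b - a i))
        = (a i * b * (b - a k) - a k * b * (b - a i)) / ((a i - a k) * (b - a i) * (b - a k))"
      using ne by (simp add: divide_simps) (simp add: algebra_simps)
    also have "a i * b * (b - a k) - a k * b * (b - a i) = (a i - a k) * (b * b)"
      by (simp add: algebra_simps)
    finally show "a k / (a k - a i) * (b / (b - a k)) + a i / (a i - a k) * (b / (b - a i))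
        = b / (b - a i) * (b / (b - a k))"
      using ne by simp
  qed
  also have "\<dots> = (\<Prod>i\<in>I. b / (b - a i)) * (b / (b - a k))"
    by (simp only: insert.IH[OF inj b(1), symmetric] sum_distrib_right mult.assoc)
  also have "\<dots> = (\<Prod>i\<in>insert k I. b / (b - a i))"
    using insert.hyps by (simp add: mult.commute)
  finally show ?case .
qed

section \<open>Sums of exponential variables with distinct means\<close>

text \<open>
  For \<open>x \<ge> 0\<close> the integrand lives on \<open>{0..x}\<close>, where it is a multiple of \<open>exp ((1 / c - 1 / d) * y)\<close>.
  The exponent does not vanish because the means differ, so the antiderivative is again a multiple
  of this exponential.
\<close>
lemma exponential_density_convolution:
  fixes c d x :: real
  assumes "c > 0" "d > 0" "c \<noteq> d"
  shows "has_bochner_integral lborel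
    (\<lambda>y. exponential_density (1 / c) (x - y) * exponential_density (1 / d) y)
    (c / (c - d) * exponential_density (1 / c) x + d / (d - c) * exponential_density (1 / d) x)"
proof (cases "x < 0")
  case True
  then have "(\<lambda>y. exponential_density (1 / c) (x - y) * exponential_density (1 / d) y) = (\<lambda>y. 0)"
    by (auto simp: exponential_density_def)
  then show ?thesis
    using True by (simp add: exponential_density_def has_bochner_integral_zero)
next
  case False
  let ?f = "\<lambda>y. exp (- (x - y) / c) / c * (exp (- y / d) / d)"
  let ?F = "\<lambda>y. exp (- (x - y) / c) * exp (- y / d) / (d - c)"
  have "has_bochner_integral lborel (\<lambda>y. ?f y * indicator {0..x} y) (?F x - ?F 0)"
  proof (rule has_bochner_integral_FTC_Icc_real)
    fix y :: real
    show "(?F has_real_derivative ?f y) (at y)"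
      using assms by (auto intro!: derivative_eq_intros simp: divide_simps) (simp add: algebra_simps)
    show "isCont ?f y"
      using assms by (intro continuous_intros) auto
  qed (use False in auto)
  also have "(\<lambda>y. ?f y * indicator {0..x} y)
      = (\<lambda>y. exponential_density (1 / c) (x - y) * exponential_density (1 / d) y)"
    by (auto simp: exponential_density_def fun_eq_iff split: split_indicator)
  also have "?F x - ?F 0
      = c / (c - d) * exponential_density (1 / c) x + d / (d - c) * exponential_density (1 / d) x"
    using False assms by (simp add: exponential_density_def divide_simps) (simp add: algebra_simps)
  finally show ?thesis .
qed

text \<open>
  A density is an \<open>ennreal\<close>-valued function, so \<open>h I\<close> enters truncated at \<open>0\<close>. Only its pointwise
  nonnegativity, proved in the same induction, shows that nothing is cut off; it holds because
  the convolution of nonnegative functions is nonnegative, and is not visible from the weights.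
\<close>
lemma (in prob_space) distributed_sum_exponential:
  fixes a :: "'i \<Rightarrow> real"
  assumes "finite I" "I \<noteq> {}" "inj_on a I"
    and "\<And>i. i \<in> I \<Longrightarrow> a i > 0"
    and "indep_vars (\<lambda>_. borel) X I"
    and "\<And>i. i \<in> I \<Longrightarrow> distributed M lborel (X i) (exponential_density (1 / a i))"
  defines "h \<equiv> \<lambda>I x. \<Sum>i\<in>I. hypoexp_weight a I i * exponential_density (1 / a i) x"
  shows "distributed M lborel (\<lambda>\<omega>. \<Sum>i\<in>I. X i \<omega>) (h I) \<and> (\<forall>x. h I x \<ge> 0)"
  using assms(1-6)
proof (induction I rule: finite_ne_induct)
  case (singleton i)
  then show ?case
    by (auto simp: h_def hypoexp_weight_def intro!: exponential_density_nonneg)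
next
  case (insert k I)
  let ?e = "\<lambda>i. exponential_density (1 / a i)"
  have inj: "inj_on a I" and ak: "a k \<notin> a ` I" and pos: "a k > 0" "\<And>i. i \<in> I \<Longrightarrow> a i > 0"
    using insert by auto
  have "indep_vars (\<lambda>_. borel) X I"
    using insert.prems(3) by (rule indep_vars_subset) auto
  with insert inj have IH: "distributed M lborel (\<lambda>\<omega>. \<Sum>i\<in>I. X i \<omega>) (h I)" "\<And>x. h I x \<ge> 0"
    by auto
  have conv: "has_bochner_integral lborel (\<lambda>y. ?e k (x - y) * h I y) (h (insert k I) x)" for x
  proof -
    have "has_bochner_integral lborel
        (\<lambda>y. \<Sum>i\<in>I. hypoexp_weight a I i * (?e k (x - y) * ?e i y))
        (\<Sum>i\<in>I. hypoexp_weight a I i *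
          (a k / (a k - a i) * ?e k x + a i / (a i - a k) * ?e i x))"
      using pos ak
      by (intro has_bochner_integral_sum has_bochner_integral_mult_right
            exponential_density_convolution) auto
    also have "(\<lambda>y. \<Sum>i\<in>I. hypoexp_weight a I i * (?e k (x - y) * ?e i y))
        = (\<lambda>y. ?e k (x - y) * h I y)"
      by (simp add: h_def sum_distrib_left mult_ac)
    also have "(\<Sum>i\<in>I. hypoexp_weight a I i *
          (a k / (a k - a i) * ?e k x + a i / (a i - a k) * ?e i x))
        = (\<Sum>i\<in>I. hypoexp_weight a I i * (a k / (a k - a i))) * ?e k x
          + (\<Sum>i\<in>I. hypoexp_weight a I i * (a i / (a i - a k)) * ?e i x)"
      by (simp only: sum_distrib_right sum.distrib[symmetric] distrib_left mult.assoc)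
    also have "(\<Sum>i\<in>I. hypoexp_weight a I i * (a k / (a k - a i)))
        = hypoexp_weight a (insert k I) k"
      using sum_hypoexp_weight[OF insert.hyps(1,2) inj ak]
      by (simp only: hypoexp_weight_insert_new[OF insert.hyps(3)])
    also have "(\<Sum>i\<in>I. hypoexp_weight a I i * (a i / (a i - a k)) * ?e i x)
        = (\<Sum>i\<in>I. hypoexp_weight a (insert k I) i * ?e i x)"
      using insert.hyps by (simp add: hypoexp_weight_insert)
    also have "hypoexp_weight a (insert k I) k * ?e k x + \<dots> = h (insert k I) x"
      using insert.hyps by (simp add: h_def)
    finally show ?thesis .
  qed
  have nonneg: "?e k (x - y) * h I y \<ge> 0" for x y
    using pos IH by (intro mult_nonneg_nonneg exponential_density_nonneg) auto
  have "h (insert k I) x \<ge> 0" for x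
  proof -
    have "0 \<le> (\<integral>y. ?e k (x - y) * h I y \<partial>lborel)"
      by (rule Bochner_Integration.integral_nonneg) (rule nonneg)
    then show ?thesis
      by (simp only: has_bochner_integral_integral_eq[OF conv])
  qed
  moreover have "distributed M lborel (\<lambda>\<omega>. \<Sum>i\<in>insert k I. X i \<omega>) (h (insert k I))"
  proof -
    have "indep_var borel (X k) borel (\<lambda>\<omega>. \<Sum>i\<in>I. X i \<omega>)"
      using insert by (intro indep_vars_sum) auto
    then have "distributed M lborel (\<lambda>\<omega>. X k \<omega> + (\<Sum>i\<in>I. X i \<omega>))
        (\<lambda>x. \<integral>\<^sup>+y. ennreal (?e k (x - y)) * ennreal (h I y) \<partial>lborel)"
      using insert.prems by (intro distributed_convolution IH(1)) auto
    also have "(\<lambda>x. \<integral>\<^sup>+y. ennreal (?e k (x - y)) * ennreal (h I y) \<partial>lborel)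
        = (\<lambda>x. ennreal (h (insert k I) x))"
    proof
      fix x
      have "(\<integral>\<^sup>+y. ennreal (?e k (x - y)) * ennreal (h I y) \<partial>lborel)
          = (\<integral>\<^sup>+y. ennreal (?e k (x - y) * h I y) \<partial>lborel)"
        using pos IH by (simp add: ennreal_mult exponential_density_nonneg)
      also have "\<dots> = ennreal (\<integral>y. ?e k (x - y) * h I y \<partial>lborel)"
        using conv nonneg by (intro nn_integral_eq_integral) (auto simp: has_bochner_integral_iff)
      also have "\<dots> = ennreal (h (insert k I) x)"
        using conv[of x] by (simp add: has_bochner_integral_iff)
      finally show "(\<integral>\<^sup>+y. ennreal (?e k (x - y)) * ennreal (h I y) \<partial>lborel) = h (insert k I) x" .
    qed
    finally show ?thesis
      using insert.hyps by simp
  qed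
  ultimately show ?case by simp
qed

lemma (in prob_space) prob_sum_exponential_ge:
  fixes a :: "'i \<Rightarrow> real"
  assumes "finite I" "I \<noteq> {}" "inj_on a I"
    and pos: "\<And>i. i \<in> I \<Longrightarrow> a i > 0"
    and "indep_vars (\<lambda>_. borel) X I"
    and "\<And>i. i \<in> I \<Longrightarrow> distributed M lborel (X i) (exponential_density (1 / a i))"
    and t: "t \<ge> 0"
  shows "prob {\<omega> \<in> space M. (\<Sum>i\<in>I. X i \<omega>) \<ge> t}
    = (\<Sum>i\<in>I. hypoexp_weight a I i * exp (- t / a i))"
proof -
  let ?S = "\<lambda>\<omega>. \<Sum>i\<in>I. X i \<omega>"
  let ?h = "\<lambda>x. \<Sum>i\<in>I. hypoexp_weight a I i * exponential_density (1 / a i) x"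
  let ?f = "\<lambda>x. \<Sum>i\<in>I. hypoexp_weight a I i * (exp (- x / a i) / a i)"
  let ?F = "\<lambda>x. \<Sum>i\<in>I. - hypoexp_weight a I i * exp (- x / a i)"
  have S: "distributed M lborel ?S ?h" and nonneg: "\<And>x. ?h x \<ge> 0"
    using distributed_sum_exponential[OF assms(1-6)] by auto
  have eq: "?h x = ?f x" if "x \<ge> t" for x
    using that t by (simp add: exponential_density_def)
  have deriv: "(?F has_real_derivative ?f x) (at x)" for x
  proof (rule DERIV_sum)
    fix i assume "i \<in> I"
    then have "a i \<noteq> 0" using pos[of i] by simp
    then show "((\<lambda>x. - hypoexp_weight a I i * exp (- x / a i)) has_real_derivative
        hypoexp_weight a I i * (exp (- x / a i) / a i)) (at x)"
      by (auto intro!: derivative_eq_intros)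
  qed
  have f_nonneg: "0 \<le> ?f x" if "t \<le> x" for x
    using nonneg[of x] eq[OF that] by simp
  have "((\<lambda>x. - hypoexp_weight a I i * exp (- x / a i)) \<longlongrightarrow> 0) at_top" if "i \<in> I" for i
  proof -
    have "filterlim (\<lambda>x. (1 / a i) * x) at_top at_top"
      using pos[OF that]
      by (intro filterlim_tendsto_pos_mult_at_top[OF tendsto_const]) (auto intro: filterlim_ident)
    then have "((\<lambda>x. exp (- x / a i)) \<longlongrightarrow> 0) at_top"
      by (intro filterlim_compose[OF exp_at_bot]) (simp add: filterlim_uminus_at_top)
    from tendsto_mult_left[OF this, of "- hypoexp_weight a I i"] show ?thesis by simp
  qed
  from tendsto_sum[OF this] have lim: "(?F \<longlongrightarrow> 0) at_top" by simp
  \<comment> \<open>The weights may have mixed signs, so that \<open>- ?F t\<close> is nonnegative is not visible termwise.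
    It follows from \<open>?F\<close> increasing to \<open>0\<close>, and it licenses the return from \<open>ennreal\<close>.\<close>
  have "?F t \<le> ?F x" if "t \<le> x" for x
    using that
  proof (rule DERIV_nonneg_imp_nondecreasing)
    fix y assume "t \<le> y"
    then show "\<exists>D. (?F has_real_derivative D) (at y) \<and> D \<ge> 0"
      by (intro exI[of _ "?f y"] conjI deriv f_nonneg)
  qed
  then have F_le: "?F t \<le> 0"
    by (intro tendsto_lowerbound[OF lim] eventually_at_top_linorderI[of t]) auto
  have "emeasure M {\<omega> \<in> space M. ?S \<omega> \<ge> t} = emeasure M (?S -` {t..} \<inter> space M)"
    by (rule arg_cong[where f = "emeasure M"]) auto
  also have "\<dots> = (\<integral>\<^sup>+x. ennreal (?h x) * indicator {t..} x \<partial>lborel)"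
    by (rule distributed_emeasure[OF S]) simp
  also have "\<dots> = (\<integral>\<^sup>+x. ennreal (?f x) * indicator {t..} x \<partial>lborel)"
    using eq by (intro nn_integral_cong) (auto split: split_indicator)
  also have "\<dots> = ennreal (0 - ?F t)"
    by (rule nn_integral_FTC_atLeast[OF _ deriv f_nonneg lim]) measurable
  finally have "emeasure M {\<omega> \<in> space M. ?S \<omega> \<ge> t} = ennreal (- ?F t)" by simp
  then have "prob {\<omega> \<in> space M. ?S \<omega> \<ge> t} = - ?F t"
    using F_le by (simp add: measure_def)
  then show ?thesis
    by (simp add: sum_negf)
qed

theorem mainTheorem1:
  fixes M :: "'a measure"
    and n :: nat
    and P :: "nat \<Rightarrow> 'a \<Rightarrow> real"
    and Pexp :: "nat \<Rightarrow> real"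
    and Ptot :: real
  assumes "prob_space M"
    and "n \<ge> 1"
    and "\<And>i. i \<in> {1..n} \<Longrightarrow> Pexp i > 0"
    and "inj_on Pexp {1..n}"
    and "Ptot \<ge> 0"
    and "prob_space.indep_vars M (\<lambda>_. borel) P {1..n}"
    and "\<And>i. i \<in> {1..n} \<Longrightarrow> distributed M lborel (P i) (exponential_density (1 / Pexp i))"
  shows "measure M {\<omega> \<in> space M. (\<Sum>i = 1..n. P i \<omega>) \<ge> Ptot} =
    (\<Sum>i = 1..n. Pexp i ^ (n - 1) * exp (- Ptot / Pexp i) /
      (\<Prod>j \<in> {1..n} - {i}. Pexp i - Pexp j))"
proof -
  have "measure M {\<omega> \<in> space M. (\<Sum>i = 1..n. P i \<omega>) \<ge> Ptot}
      = (\<Sum>i = 1..n. hypoexp_weight Pexp {1..n} i * exp (- Ptot / Pexp i))"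
    using assms by (intro prob_space.prob_sum_exponential_ge) auto
  also have "\<dots> = (\<Sum>i = 1..n. Pexp i ^ (n - 1) * exp (- Ptot / Pexp i) /
      (\<Prod>j \<in> {1..n} - {i}. Pexp i - Pexp j))"
    by (intro sum.cong) (simp_all add: hypoexp_weight_eq_quotient)
  finally show ?thesis .
qed

end
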